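(* Let $(C,\bar\xi)$ be a versor field in a Myller configuration with alternative frame $R_A=\{P(s);\bar\xi_2(s),\bar Y(s),\bar D(s)\}$ and alternative curvatures $p,q$. Consider a variation of the alternative frame $R_A\{P(s);\bar\xi_2(s),\bar Y(s),\bar D(s)\}\rightarrow R_A^{*}\{P^{*}(s+\Delta s);\bar\xi_2(s+\Delta s),\bar Y(s+\Delta s),\bar D(s+\Delta s)\}$. Let $\varphi_1$ be the oriented angle between the successive versor fields $\bar\xi_2(s)$, and let $\varphi_2$ be the oriented angle between the successive versor fields $\bar D(s)$. Then the alternative curvatures $p$ and $q$ of the versor field $(C,\bar\xi)$ are given by $$p=\left|\frac{d\varphi_1}{ds}\right|,\qquad q=\left|\frac{d\varphi_2}{ds}\right|,$$ respectively.
   Context: Let $C$ be a curve in Euclidean space $E^3$ with arclength parameter $s\in I$ ($I$ an interval) and position vector $\bar r(s)$ of the point $P(s)$, let $\bar\xi(s)$ be a unit vector field along $C$ (a versor field $(C,\bar\xi)$), and let $\pi(s)$ be a plane field along $C$ with $\bar\xi(s)\in\pi(s)$. The pair $((C,\bar\xi),(C,\pi))$ is called a Myller configuration $M=M(C,\bar\xi,\pi)$. Put $\bar\xi_1=\bar\xi$, $K_1=\|d\bar\xi/ds\|>0$ (curvature), define $\bar\xi_2$ by $\bar\xi_1'=K_1\bar\xi_2$, and $\bar\xi_3=\bar\xi_1\times\bar\xi_2$. Then $\{\bar\xi_1,\bar\xi_2,\bar\xi_3\}$ is a positively oriented orthonormal frame, the Frenet-type frame $R_F$, and $$\bar\xi_1'=K_1\bar\xi_2,\quad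 \bar\xi_2'=-K_1\bar\xi_1+K_2\bar\xi_3,\quad \bar\xi_3'=-K_2\bar\xi_2,$$ which defines the torsion $K_2$. A prime denotes $d/ds$. The alternative frame (AF-frame) is the orthonormal frame $R_A=\{P(s);\bar\xi_2,\bar Y,\bar D\}$ with $\bar Y=\bar\xi_2'/\|\bar\xi_2'\|$ and $\bar D=\bar\xi_2\times\bar Y=\frac{K_2}{\sqrt{K_1^2+K_2^2}}\bar\xi_1+\frac{K_1}{\sqrt{K_1^2+K_2^2}}\bar\xi_3$. It satisfies $\bar\xi_2'=p\bar Y$, $\bar Y'=-p\bar\xi_2+q\bar D$, $\bar D'=-q\bar Y$, where the alternative curvatures are $p=\sqrt{K_1^2+K_2^2}$ and $q=\frac{K_1^2}{K_1^2+K_2^2}\left(\frac{K_2}{K_1}\right)'$. The oriented angle $\varphi_1$ is understood so that the angle between $\bar\xi_2(s)$ and $\bar\xi_2(s+\Delta s)$ is $|\varphi_1(s+\Delta s)-\varphi_1(s)|$; similarly, $\varphi_2$ is understood so that the angle between $\bar D(s)$ and $\bar D(s+\Delta s)$ is $|\varphi_2(s+\Delta s)-\varphi_2(s)|$.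
   Formalization: Since q as defined can be negative (e.g. K_1=1, K_2=-s), q=|dφ_2/ds| is false where q<0; what is proved is |q|=|dφ_2/ds| everywhere and q=|dφ_2/ds| wherever q≥0. The formula for p is unchanged. *)

theory Defs
  imports "HOL-Analysis.Analysis"
begin

text \<open>Derivative along the parameter interval; one-sided at an endpoint belonging to \<open>I\<close>.\<close>

definition ddt :: "real set \<Rightarrow> (real \<Rightarrow> 'a::real_normed_vector) \<Rightarrow> real \<Rightarrow> 'a" where
  "ddt I f s = vector_derivative f (at s within I)"

text \<open>The plane \<open>\<pi>(s)\<close> through \<open>P(s)\<close> is given by its two-dimensional direction space \<open>\<pi> s\<close>.
  Three-fold differentiability of \<open>\<xi>\<close> is what the derivative of the torsion needs.\<close>

definition myller_configuration ::
    "real set \<Rightarrow> (real \<Rightarrow> real^3) \<Rightarrow> (real \<Rightarrow> real^3) \<Rightarrow> (real \<Rightarrow> (real^3) set) \<Rightarrow> bool" where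
  "myller_configuration I r \<xi> \<pi> \<longleftrightarrow>
     is_interval I \<and> (\<exists>a\<in>I. \<exists>b\<in>I. a < b) \<and>
     (\<forall>s\<in>I. r differentiable (at s within I) \<and> norm (ddt I r s) = 1) \<and>
     (\<forall>s\<in>I. norm (\<xi> s) = 1) \<and>
     (\<forall>k<3. \<forall>s\<in>I. (ddt I ^^ k) \<xi> differentiable (at s within I)) \<and>
     (\<forall>s\<in>I. norm (ddt I \<xi> s) > 0) \<and>
     (\<forall>s\<in>I. subspace (\<pi> s) \<and> dim (\<pi> s) = 2 \<and> \<xi> s \<in> \<pi> s)"

definition K1 :: "real set \<Rightarrow> (real \<Rightarrow> real^3) \<Rightarrow> real \<Rightarrow> real" where
  "K1 I \<xi> s = norm (ddt I \<xi> s)"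

definition xi2 :: "real set \<Rightarrow> (real \<Rightarrow> real^3) \<Rightarrow> real \<Rightarrow> real^3" where
  "xi2 I \<xi> s = ddt I \<xi> s /\<^sub>R K1 I \<xi> s"

definition xi3 :: "real set \<Rightarrow> (real \<Rightarrow> real^3) \<Rightarrow> real \<Rightarrow> real^3" where
  "xi3 I \<xi> s = cross3 (\<xi> s) (xi2 I \<xi> s)"

text \<open>The torsion is the \<open>\<xi>\<^sub>3\<close>-component in the Frenet equation
  \<open>\<xi>\<^sub>2' = - K\<^sub>1 \<xi>\<^sub>1 + K\<^sub>2 \<xi>\<^sub>3\<close>.\<close>

definition K2 :: "real set \<Rightarrow> (real \<Rightarrow> real^3) \<Rightarrow> real \<Rightarrow> real" where
  "K2 I \<xi> s = ddt I (xi2 I \<xi>) s \<bullet> xi3 I \<xi> s"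

definition af_Y :: "real set \<Rightarrow> (real \<Rightarrow> real^3) \<Rightarrow> real \<Rightarrow> real^3" where
  "af_Y I \<xi> s = ddt I (xi2 I \<xi>) s /\<^sub>R norm (ddt I (xi2 I \<xi>) s)"

definition af_D :: "real set \<Rightarrow> (real \<Rightarrow> real^3) \<Rightarrow> real \<Rightarrow> real^3" where
  "af_D I \<xi> s = cross3 (xi2 I \<xi> s) (af_Y I \<xi> s)"

definition af_p :: "real set \<Rightarrow> (real \<Rightarrow> real^3) \<Rightarrow> real \<Rightarrow> real" where
  "af_p I \<xi> s = sqrt ((K1 I \<xi> s)\<^sup>2 + (K2 I \<xi> s)\<^sup>2)"

definition af_q :: "real set \<Rightarrow> (real \<Rightarrow> real^3) \<Rightarrow> real \<Rightarrow> real" where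
  "af_q I \<xi> s = (K1 I \<xi> s)\<^sup>2 / ((K1 I \<xi> s)\<^sup>2 + (K2 I \<xi> s)\<^sup>2)
                  * ddt I (\<lambda>t. K2 I \<xi> t / K1 I \<xi> t) s"

definition vec_angle :: "'a::real_inner \<Rightarrow> 'a \<Rightarrow> real" where
  "vec_angle u v = arccos (u \<bullet> v / (norm u * norm v))"

text \<open>\<open>\<phi>\<close> measures the oriented angle swept by \<open>V\<close> from the base point \<open>s\<close>: for all parameters
  \<open>s + \<Delta>s\<close> of \<open>I\<close> near \<open>s\<close> the angle between \<open>V(s)\<close> and \<open>V(s + \<Delta>s)\<close> is
  \<open>\<bar>\<phi>(s + \<Delta>s) - \<phi>(s)\<bar>\<close>. The base point is fixed on purpose: one function with this property
  at every \<open>s\<close> would force \<open>V\<close> to run along a great circle.\<close>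

definition oriented_angle ::
    "real set \<Rightarrow> (real \<Rightarrow> 'a::real_inner) \<Rightarrow> real \<Rightarrow> (real \<Rightarrow> real) \<Rightarrow> bool" where
  "oriented_angle I V s \<phi> \<longleftrightarrow>
     (\<forall>\<^sub>F t in at s within I. vec_angle (V s) (V t) = \<bar>\<phi> t - \<phi> s\<bar>)"

end

theory Submission
  imports Defs
begin

text \<open>An alternative curvature is the speed of a unit vector field: \<open>p = \<parallel>\<xi>\<^sub>2'\<parallel>\<close> and
  \<open>\<bar>q\<bar> = \<parallel>D'\<parallel>\<close>. The speed of a unit field \<open>V\<close> is also the rate at which \<open>V\<close> turns. Two unit
  vectors at angle \<open>\<theta>\<close> are the endpoints of a chord of length \<open>2 sin (\<theta>/2)\<close>, so if \<open>\<phi>\<close> measures the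
  oriented angle from the base point \<open>s\<close>, then \<open>V\<close> moves away from \<open>V(s)\<close> exactly as far as the real
  function \<open>g(t) = 2 sin ((\<phi>(t) - \<phi>(s))/2)\<close> moves away from \<open>g(s) = 0\<close>. Equal distances give
  derivatives of equal norm, and \<open>g'(s) = \<phi>'(s)\<close>; hence \<open>\<parallel>V'(s)\<parallel> = \<bar>\<phi>'(s)\<bar>\<close>
  (\<open>oriented_angle_speed\<close>).

  It remains to compute the two speeds. For \<open>\<xi>\<^sub>2\<close> it is Pythagoras in the Frenet equation
  \<open>\<xi>\<^sub>2' = - K\<^sub>1 \<xi>\<^sub>1 + K\<^sub>2 \<xi>\<^sub>3\<close> (\<open>norm_ddt_xi2\<close>). For \<open>D\<close>, put \<open>h = K\<^sub>2/K\<^sub>1\<close>; then \<open>D\<close> is the normalization of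
  \<open>N = h \<xi>\<^sub>1 + \<xi>\<^sub>3\<close>, the Darboux vector divided by \<open>K\<^sub>1\<close>. The contributions of \<open>\<xi>\<^sub>1'\<close> and \<open>\<xi>\<^sub>3'\<close> to \<open>N'\<close>
  cancel, which leaves \<open>N' = h' \<xi>\<^sub>1\<close>. The component of \<open>N'\<close> orthogonal to \<open>N\<close>, divided by
  \<open>\<parallel>N\<parallel>\<close>, has norm \<open>\<bar>h'\<bar>/(1 + h\<^sup>2)\<close>, and this is \<open>\<bar>q\<bar>\<close> (\<open>af_D_speed\<close>).

  A speed is nonnegative while \<open>q\<close> may have either sign, so the angle determines \<open>\<bar>q\<bar>\<close>, and
  \<open>q\<close> itself where \<open>q \<ge> 0\<close>.\<close>

section \<open>Rates of separation and angles of unit vectors\<close>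

text \<open>The first-order remainder bounds the difference of the two norms, by the reverse triangle
  inequality. Taking norms removes the sign of \<open>t - s\<close>, so no case distinction between the two
  sides of \<open>s\<close> arises.\<close>

lemma norm_difference_quotient_tendsto:
  fixes f :: "real \<Rightarrow> 'a::real_normed_vector"
  assumes "(f has_vector_derivative v) (at s within I)"
  shows "((\<lambda>t. norm (f t - f s) / \<bar>t - s\<bar>) \<longlongrightarrow> norm v) (at s within I)"
proof -
  have lim: "((\<lambda>t. (f t - f s - (t - s) *\<^sub>R v) /\<^sub>R norm (t - s)) \<longlongrightarrow> 0) (at s within I)"
    using assms unfolding has_vector_derivative_def has_derivative_at_within by blast
  have "((\<lambda>t. norm (f t - f s) / \<bar>t - s\<bar> - norm v) \<longlongrightarrow> 0) (at s within I)"
  proof (rule Lim_null_comparison[OF _ tendsto_norm_zero[OF lim]])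
    show "\<forall>\<^sub>F t in at s within I. norm (norm (f t - f s) / \<bar>t - s\<bar> - norm v)
        \<le> norm ((f t - f s - (t - s) *\<^sub>R v) /\<^sub>R norm (t - s))"
      unfolding eventually_at_filter
    proof (intro always_eventually allI impI)
      fix t assume "t \<noteq> s" "t \<in> I"
      then have "norm (f t - f s) / \<bar>t - s\<bar> - norm v
          = (norm (f t - f s) - norm ((t - s) *\<^sub>R v)) / \<bar>t - s\<bar>"
        by (simp add: diff_divide_distrib)
      then have "norm (norm (f t - f s) / \<bar>t - s\<bar> - norm v)
          = \<bar>norm (f t - f s) - norm ((t - s) *\<^sub>R v)\<bar> / \<bar>t - s\<bar>"
        by simp
      also have "\<dots> \<le> norm (f t - f s - (t - s) *\<^sub>R v) / \<bar>t - s\<bar>"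
        by (intro divide_right_mono norm_triangle_ineq3) simp
      finally show "norm (norm (f t - f s) / \<bar>t - s\<bar> - norm v)
          \<le> norm ((f t - f s - (t - s) *\<^sub>R v) /\<^sub>R norm (t - s))"
        by (simp add: divide_inverse mult.commute)
    qed
  qed
  then show ?thesis
    by (simp add: LIM_zero_iff)
qed

text \<open>The fields may take values in different spaces: this is what transfers the speed of a unit
  field in space to a real function of its angle.\<close>

lemma norm_derivatives_eq:
  fixes f :: "real \<Rightarrow> 'a::real_normed_vector" and g :: "real \<Rightarrow> 'b::real_normed_vector"
  assumes "at s within I \<noteq> bot"
    and "(f has_vector_derivative v) (at s within I)"
    and "(g has_vector_derivative w) (at s within I)"
    and "\<forall>\<^sub>F t in at s within I. norm (f t - f s) = norm (g t - g s)"
  shows "norm v = norm w"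
proof (rule tendsto_unique[OF assms(1)])
  show "((\<lambda>t. norm (f t - f s) / \<bar>t - s\<bar>) \<longlongrightarrow> norm v) (at s within I)"
    using assms(2) by (rule norm_difference_quotient_tendsto)
  have "((\<lambda>t. norm (g t - g s) / \<bar>t - s\<bar>) \<longlongrightarrow> norm w) (at s within I)"
    using assms(3) by (rule norm_difference_quotient_tendsto)
  then show "((\<lambda>t. norm (f t - f s) / \<bar>t - s\<bar>) \<longlongrightarrow> norm w) (at s within I)"
    by (rule Lim_transform_eventually) (use assms(4) in eventually_elim, simp)
qed

text \<open>The chord has squared length \<open>2 - 2 cos \<theta> = 4 sin\<^sup>2 (\<theta>/2)\<close>. Passing to the chord
  avoids the arc cosine, which is not differentiable at \<open>1\<close>, the value belonging to the base
  point.\<close>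

lemma chord_length_eq_sin_half_vec_angle:
  fixes u v :: "'a::real_inner"
  assumes "norm u = 1" "norm v = 1"
  shows "norm (v - u) = \<bar>2 * sin (vec_angle u v / 2)\<bar>"
proof -
  have "\<bar>u \<bullet> v\<bar> \<le> 1"
    using Cauchy_Schwarz_ineq2[of u v] assms by simp
  then have "u \<bullet> v = cos (2 * (vec_angle u v / 2))"
    using assms by (simp add: vec_angle_def abs_le_iff)
  also have "\<dots> = 1 - 2 * (sin (vec_angle u v / 2))\<^sup>2"
    by (rule cos_double_sin)
  finally have "(norm (v - u))\<^sup>2 = \<bar>2 * sin (vec_angle u v / 2)\<bar>\<^sup>2"
    using assms unfolding power2_norm_eq_inner
    by (simp add: inner_diff inner_commute norm_eq_1 power_mult_distrib)
  then show ?thesis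
    by (rule power2_eq_imp_eq) simp_all
qed

text \<open>The chord from \<open>V(s)\<close> to \<open>V(t)\<close> has length \<open>2 sin (\<bar>\<phi>(t) - \<phi>(s)\<bar>/2)\<close>. Dropping the inner
  absolute value changes at most the sign of the sine and leaves a function that is differentiable
  at \<open>s\<close>, with derivative \<open>\<phi>'(s)\<close>; its distances to its value at \<open>s\<close> are still the chord lengths.\<close>

lemma oriented_angle_speed:
  fixes V :: "real \<Rightarrow> 'a::real_inner"
  assumes nontriv: "at s within I \<noteq> bot" and "s \<in> I"
    and unit: "\<And>t. t \<in> I \<Longrightarrow> norm (V t) = 1"
    and V: "(V has_vector_derivative v) (at s within I)"
    and angle: "oriented_angle I V s \<phi>"
    and \<phi>: "(\<phi> has_vector_derivative d) (at s within I)"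
  shows "norm v = \<bar>d\<bar>"
proof -
  define g where "g = (\<lambda>t. 2 * sin ((\<phi> t - \<phi> s) / 2))"
  have g: "(g has_vector_derivative d) (at s within I)"
    using \<phi> unfolding g_def has_real_derivative_iff_has_vector_derivative[symmetric]
    by (auto intro!: derivative_eq_intros)
  have "\<forall>\<^sub>F t in at s within I. t \<in> I"
    by (simp add: eventually_at_filter)
  with angle[unfolded oriented_angle_def]
  have "\<forall>\<^sub>F t in at s within I. norm (V t - V s) = norm (g t - g s)"
  proof eventually_elim
    case (elim t)
    have "\<bar>sin (\<bar>x\<bar> / 2)\<bar> = \<bar>sin (x / 2)\<bar>" for x :: real
      by (cases "0 \<le> x") simp_all
    then show ?case
      using chord_length_eq_sin_half_vec_angle[OF unit[OF \<open>s \<in> I\<close>] unit[OF elim(2)]] elim(1)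
      by (simp add: g_def abs_mult)
  qed
  then have "norm v = norm d"
    by (rule norm_derivatives_eq[OF nontriv V g])
  then show ?thesis by simp
qed

section \<open>Differentiation of normalized fields\<close>

text \<open>The norm grows at the rate \<open>N' \<bullet> sgn N\<close>, so the quotient rule removes from \<open>N'\<close> its component
  along \<open>N\<close>.\<close>

lemma sgn_has_vector_derivative:
  fixes N :: "real \<Rightarrow> 'a::real_inner"
  assumes N: "(N has_vector_derivative N') (at s within I)" and nz: "N s \<noteq> 0"
  shows "((\<lambda>t. sgn (N t)) has_vector_derivative
          (N' - (N' \<bullet> sgn (N s)) *\<^sub>R sgn (N s)) /\<^sub>R norm (N s)) (at s within I)"
proof -
  have d: "((\<lambda>t. norm (N t)) has_vector_derivative (N' \<bullet> sgn (N s))) (at s within I)"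
    using has_derivative_compose[OF N[unfolded has_vector_derivative_def] has_derivative_norm[OF nz]]
    by (simp add: has_vector_derivative_def)
  have "((\<lambda>t. inverse (norm (N t))) has_real_derivative
     - (inverse (norm (N s)) * (N' \<bullet> sgn (N s)) * inverse (norm (N s)))) (at s within I)"
    using DERIV_inverse'[OF d[folded has_real_derivative_iff_has_vector_derivative]] nz by simp
  from has_vector_derivative_scaleR[OF this N]
  show ?thesis
    by (simp add: sgn_div_norm scaleR_right_diff_distrib mult.assoc algebra_simps)
qed

lemma norm_sgn_derivative_sq:
  fixes n m :: "'a::real_inner"
  assumes "n \<noteq> 0"
  shows "(norm ((m - (m \<bullet> sgn n) *\<^sub>R sgn n) /\<^sub>R norm n))\<^sup>2
       = ((norm m)\<^sup>2 - (m \<bullet> sgn n)\<^sup>2) / (norm n)\<^sup>2"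
proof -
  define u where "u = sgn n"
  have u: "u \<bullet> u = 1"
    using assms by (simp add: u_def norm_sgn flip: norm_eq_1)
  have "(norm (m - (m \<bullet> u) *\<^sub>R u))\<^sup>2 = (norm m)\<^sup>2 - (m \<bullet> u)\<^sup>2"
    unfolding power2_norm_eq_inner by (simp add: inner_diff inner_commute u power2_eq_square)
  then show ?thesis
    by (simp add: u_def power_mult_distrib divide_inverse power_inverse mult.commute)
qed

section \<open>Orthonormal frames in space\<close>

text \<open>Writing \<open>c = a \<times> b\<close>, Lagrange's identity gives \<open>c \<times> v = (v \<bullet> a) b\<close>. A second product with
  \<open>c\<close> turns this into \<open>- (v \<bullet> a) a\<close> on one side and \<open>(v \<bullet> c) c - v\<close> on the other.\<close>

lemma expand_orthogonal_to:
  fixes a b v :: "real^3"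
  assumes "a \<bullet> a = 1" "b \<bullet> b = 1" "a \<bullet> b = 0" "v \<bullet> b = 0"
  shows "v = (v \<bullet> a) *\<^sub>R a + (v \<bullet> cross3 a b) *\<^sub>R cross3 a b"
proof -
  let ?c = "cross3 a b"
  have cc: "?c \<bullet> ?c = 1"
    using assms by (simp add: dot_cross inner_commute)
  have cv: "cross3 ?c v = (v \<bullet> a) *\<^sub>R b"
    using assms Lagrange[of v a b] cross_skew[of ?c v] by (simp add: inner_commute)
  have cb: "cross3 ?c b = - a"
    using assms Lagrange[of b a b] cross_skew[of ?c b] by (simp add: inner_commute)
  have "cross3 ?c (cross3 ?c v) = (?c \<bullet> v) *\<^sub>R ?c - v"
    using Lagrange[of ?c ?c v] cc by simp
  then show ?thesis
    unfolding cv cross_mult_right cb by (simp add: inner_commute algebra_simps)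
qed

section \<open>The Frenet-type frame of a Myller configuration\<close>

lemma ddt_works:
  "f differentiable (at s within I) \<Longrightarrow> (f has_vector_derivative ddt I f s) (at s within I)"
  by (simp add: ddt_def vector_derivative_works)

lemma ddt_eqI:
  assumes "at s within I \<noteq> bot" "(f has_vector_derivative v) (at s within I)"
  shows "ddt I f s = v"
  using assms by (simp add: ddt_def vector_derivative_within)

context
  fixes I :: "real set" and r \<xi> :: "real \<Rightarrow> real^3" and \<pi> :: "real \<Rightarrow> (real^3) set"
  assumes M: "myller_configuration I r \<xi> \<pi>"
begin

lemma at_within_nontrivial:
  assumes "s \<in> I"
  shows "at s within I \<noteq> bot"
proof -
  have "connected I" "\<And>x. I \<noteq> {x}"
    using M by (auto simp: myller_configuration_def is_interval_connected_1)
  then show ?thesis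
    using connected_imp_perfect[OF _ assms] by (simp add: trivial_limit_within)
qed

lemma unit_\<xi>: "s \<in> I \<Longrightarrow> norm (\<xi> s) = 1"
  and deriv_\<xi>_nonzero: "s \<in> I \<Longrightarrow> ddt I \<xi> s \<noteq> 0"
  using M by (auto simp: myller_configuration_def)

lemma has_derivs_\<xi>:
  assumes "s \<in> I"
  shows "(\<xi> has_vector_derivative ddt I \<xi> s) (at s within I)"
    and "(ddt I \<xi> has_vector_derivative ddt I (ddt I \<xi>) s) (at s within I)"
    and "(ddt I (ddt I \<xi>) has_vector_derivative ddt I (ddt I (ddt I \<xi>)) s) (at s within I)"
proof -
  have "\<forall>k<3. (ddt I ^^ k) \<xi> differentiable (at s within I)"
    using M assms by (auto simp: myller_configuration_def)
  then show "(\<xi> has_vector_derivative ddt I \<xi> s) (at s within I)"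
    and "(ddt I \<xi> has_vector_derivative ddt I (ddt I \<xi>) s) (at s within I)"
    and "(ddt I (ddt I \<xi>) has_vector_derivative ddt I (ddt I (ddt I \<xi>)) s) (at s within I)"
    by (auto intro!: ddt_works simp: numeral_3_eq_3 All_less_Suc)
qed

lemma xi2_eq_sgn: "xi2 I \<xi> s = sgn (ddt I \<xi> s)"
  by (simp add: xi2_def K1_def sgn_div_norm)

lemma K1_pos: "s \<in> I \<Longrightarrow> 0 < K1 I \<xi> s"
  by (simp add: K1_def deriv_\<xi>_nonzero)

lemma unit_xi2: "s \<in> I \<Longrightarrow> norm (xi2 I \<xi> s) = 1"
  by (simp add: xi2_eq_sgn norm_sgn deriv_\<xi>_nonzero)

lemma ddt_\<xi>: "s \<in> I \<Longrightarrow> ddt I \<xi> s = K1 I \<xi> s *\<^sub>R xi2 I \<xi> s"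
  using K1_pos[of s] by (simp add: xi2_def)

text \<open>The product rule for a constant inner product. It supplies the skew-symmetry of the Frenet
  equations.\<close>

lemma orthogonal_derivatives:
  fixes f g :: "real \<Rightarrow> 'a::real_inner"
  assumes "s \<in> I" "\<And>t. t \<in> I \<Longrightarrow> f t \<bullet> g t = c"
    and f: "(f has_vector_derivative f') (at s within I)"
    and g: "(g has_vector_derivative g') (at s within I)"
  shows "f s \<bullet> g' + f' \<bullet> g s = 0"
proof -
  have "((\<lambda>t. c) has_vector_derivative f s \<bullet> g' + f' \<bullet> g s) (at s within I)"
    using bounded_bilinear.has_vector_derivative[OF bounded_bilinear_inner f g] assms(1,2)
    by (auto intro: has_vector_derivative_transform[of s I "\<lambda>t. c" "\<lambda>t. f t \<bullet> g t"])
  then show ?thesis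
    using vector_derivative_unique_within[OF at_within_nontrivial[OF assms(1)]]
      has_vector_derivative_const by blast
qed

lemma \<xi>_orthogonal_xi2:
  assumes "s \<in> I"
  shows "\<xi> s \<bullet> xi2 I \<xi> s = 0"
proof -
  have "\<xi> t \<bullet> \<xi> t = 1" if "t \<in> I" for t
    using unit_\<xi>[OF that] by (simp add: norm_eq_1)
  from orthogonal_derivatives[OF assms this has_derivs_\<xi>(1) has_derivs_\<xi>(1)]
  have "\<xi> s \<bullet> ddt I \<xi> s = 0"
    using assms by (simp add: inner_commute)
  then show ?thesis by (simp add: xi2_def)
qed

text \<open>The explicit formula shows that \<open>\<xi>\<^sub>2'\<close> is a differentiable expression in
  \<open>\<xi>'\<close> and \<open>\<xi>''\<close>, which makes the torsion differentiable.\<close>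

lemma ddt_xi2:
  assumes "s \<in> I"
  shows "(xi2 I \<xi> has_vector_derivative ddt I (xi2 I \<xi>) s) (at s within I)" (is ?has)
    and "ddt I (xi2 I \<xi>) s =
      (ddt I (ddt I \<xi>) s - (ddt I (ddt I \<xi>) s \<bullet> xi2 I \<xi> s) *\<^sub>R xi2 I \<xi> s) /\<^sub>R norm (ddt I \<xi> s)"
      (is ?eq)
proof -
  have *: "(xi2 I \<xi> has_vector_derivative
      (ddt I (ddt I \<xi>) s - (ddt I (ddt I \<xi>) s \<bullet> xi2 I \<xi> s) *\<^sub>R xi2 I \<xi> s) /\<^sub>R norm (ddt I \<xi> s))
      (at s within I)"
    using sgn_has_vector_derivative[OF has_derivs_\<xi>(2) deriv_\<xi>_nonzero] assms
    by (simp add: xi2_eq_sgn[abs_def])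
  show ?eq
    using at_within_nontrivial[OF assms] * by (rule ddt_eqI)
  with * show ?has by simp
qed

lemma Frenet_xi2:
  assumes "s \<in> I"
  shows "ddt I (xi2 I \<xi>) s = - K1 I \<xi> s *\<^sub>R \<xi> s + K2 I \<xi> s *\<^sub>R xi3 I \<xi> s"
proof -
  have "xi2 I \<xi> t \<bullet> xi2 I \<xi> t = 1" if "t \<in> I" for t
    using unit_xi2[OF that] by (simp add: norm_eq_1)
  from orthogonal_derivatives[OF assms this ddt_xi2(1) ddt_xi2(1)]
  have 2: "ddt I (xi2 I \<xi>) s \<bullet> xi2 I \<xi> s = 0"
    using assms by (simp add: inner_commute)
  from orthogonal_derivatives[OF assms \<xi>_orthogonal_xi2 has_derivs_\<xi>(1) ddt_xi2(1)]
  have 1: "ddt I (xi2 I \<xi>) s \<bullet> \<xi> s = - K1 I \<xi> s"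
    using assms unit_xi2[OF assms] by (simp add: inner_commute ddt_\<xi> norm_eq_1)
  show ?thesis
    using expand_orthogonal_to[of "\<xi> s" "xi2 I \<xi> s" "ddt I (xi2 I \<xi>) s"] assms 1 2
      unit_\<xi>[OF assms] unit_xi2[OF assms] \<xi>_orthogonal_xi2[OF assms]
    by (simp add: K2_def xi3_def norm_eq_1)
qed

lemma frame_products:
  assumes "s \<in> I"
  shows "norm (xi3 I \<xi> s) = 1" "\<xi> s \<bullet> xi3 I \<xi> s = 0" "xi2 I \<xi> s \<bullet> xi3 I \<xi> s = 0"
    "cross3 (xi2 I \<xi> s) (xi3 I \<xi> s) = \<xi> s" "cross3 (xi2 I \<xi> s) (\<xi> s) = - xi3 I \<xi> s"
    "cross3 (\<xi> s) (xi3 I \<xi> s) = - xi2 I \<xi> s"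
  using unit_\<xi>[OF assms] unit_xi2[OF assms] \<xi>_orthogonal_xi2[OF assms]
  by (simp_all add: xi3_def norm_eq_1 dot_cross dot_cross_self inner_commute Lagrange
      cross_skew[of "xi2 I \<xi> s" "\<xi> s"])

lemma norm_ddt_xi2:
  assumes "s \<in> I"
  shows "norm (ddt I (xi2 I \<xi>) s) = af_p I \<xi> s"
proof -
  have "(norm (ddt I (xi2 I \<xi>) s))\<^sup>2 = (K1 I \<xi> s)\<^sup>2 + (K2 I \<xi> s)\<^sup>2"
    using unit_\<xi>[OF assms] frame_products(1,2)[OF assms]
    unfolding power2_norm_eq_inner Frenet_xi2[OF assms]
    by (simp add: inner_add inner_diff inner_commute norm_eq_1 power2_eq_square)
  then show ?thesis
    by (metis af_p_def norm_ge_zero real_sqrt_unique)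
qed

section \<open>The third alternative frame vector and its speed\<close>

lemma xi3_has_vector_derivative:
  assumes "s \<in> I"
  shows "(xi3 I \<xi> has_vector_derivative - K2 I \<xi> s *\<^sub>R xi2 I \<xi> s) (at s within I)"
proof -
  have bb: "bounded_bilinear (cross3 :: real^3 \<Rightarrow> _)"
    using bilinear_cross bilinear_conv_bounded_bilinear by blast
  have "cross3 (\<xi> s) (ddt I (xi2 I \<xi>) s) + cross3 (ddt I \<xi> s) (xi2 I \<xi> s)
      = - K2 I \<xi> s *\<^sub>R xi2 I \<xi> s"
    using frame_products(6)[OF assms] assms
    by (simp add: Frenet_xi2 ddt_\<xi> Cross3.right_diff_distrib cross_mult_right cross_mult_left)
  with bounded_bilinear.has_vector_derivative[OF bb has_derivs_\<xi>(1)[OF assms] ddt_xi2(1)[OF assms]]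
  show ?thesis
    by (simp add: xi3_def[abs_def])
qed

lemma K1_differentiable:
  assumes "s \<in> I"
  shows "K1 I \<xi> differentiable (at s within I)"
  using has_derivative_compose[OF has_derivs_\<xi>(2)[OF assms, unfolded has_vector_derivative_def]
      has_derivative_norm[OF deriv_\<xi>_nonzero[OF assms]]]
  unfolding differentiable_def K1_def[abs_def] by blast

text \<open>The torsion contains \<open>\<xi>''\<close> through \<open>\<xi>\<^sub>2'\<close>; differentiating it uses the third derivative
  of \<open>\<xi>\<close>.\<close>

lemma K2_differentiable:
  assumes "s \<in> I"
  shows "K2 I \<xi> differentiable (at s within I)"
proof -
  have "(\<lambda>t. ((ddt I (ddt I \<xi>) t - (ddt I (ddt I \<xi>) t \<bullet> xi2 I \<xi> t) *\<^sub>R xi2 I \<xi> t)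
      /\<^sub>R K1 I \<xi> t) \<bullet> xi3 I \<xi> t) differentiable (at s within I)"
    using K1_differentiable[OF assms] K1_pos[OF assms]
      has_derivs_\<xi>(3)[OF assms, THEN differentiableI_vector]
      ddt_xi2(1)[OF assms, THEN differentiableI_vector]
      xi3_has_vector_derivative[OF assms, THEN differentiableI_vector]
    by auto
  then show ?thesis
    by (rule differentiable_transform_within[OF _ zero_less_one assms])
       (simp add: K2_def ddt_xi2(2) K1_def)
qed

text \<open>By the Frenet equation \<open>\<xi>\<^sub>2 \<times> \<xi>\<^sub>2' = K\<^sub>2 \<xi>\<^sub>1 + K\<^sub>1 \<xi>\<^sub>3\<close>, and \<open>\<xi>\<^sub>2 \<times> \<xi>\<^sub>2'\<close> has the length of \<open>\<xi>\<^sub>2'\<close>.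
  Dividing by \<open>K\<^sub>1 > 0\<close> does not change the direction; it is done because the derivative of the
  rescaled vector has only a \<open>\<xi>\<^sub>1\<close>-component.\<close>

lemma af_D_eq_sgn:
  assumes "s \<in> I"
  shows "af_D I \<xi> s = sgn ((K2 I \<xi> s / K1 I \<xi> s) *\<^sub>R \<xi> s + xi3 I \<xi> s)" (is "_ = sgn ?N")
proof -
  have "K1 I \<xi> s *\<^sub>R ?N = cross3 (xi2 I \<xi> s) (ddt I (xi2 I \<xi>) s)"
    using K1_pos[OF assms] frame_products(4,5)[OF assms]
    by (simp add: Frenet_xi2[OF assms] Cross3.right_diff_distrib cross_mult_right scaleR_add_right)
  moreover have "norm (cross3 (xi2 I \<xi> s) (ddt I (xi2 I \<xi>) s)) = norm (ddt I (xi2 I \<xi>) s)"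
  proof -
    have "xi2 I \<xi> s \<bullet> ddt I (xi2 I \<xi>) s = 0"
      using frame_products(3)[OF assms] \<xi>_orthogonal_xi2[OF assms]
      by (simp add: Frenet_xi2[OF assms] inner_add inner_diff inner_commute)
    then show ?thesis
      using norm_cross_dot[of "xi2 I \<xi> s" "ddt I (xi2 I \<xi>) s"] unit_xi2[OF assms]
      by (simp add: power2_eq_iff_nonneg)
  qed
  ultimately have "af_D I \<xi> s = sgn (K1 I \<xi> s *\<^sub>R ?N)"
    by (simp add: af_D_def af_Y_def cross_mult_right sgn_div_norm)
  then show ?thesis
    using K1_pos[OF assms] by (simp only: sgn_scaleR sgn_pos scaleR_one)
qed

lemma unit_af_D:
  assumes "s \<in> I"
  shows "norm (af_D I \<xi> s) = 1"
proof -
  have "((K2 I \<xi> s / K1 I \<xi> s) *\<^sub>R \<xi> s + xi3 I \<xi> s) \<bullet> xi3 I \<xi> s = 1"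
    using frame_products(1,2)[OF assms] by (simp add: inner_add norm_eq_1)
  then show ?thesis
    by (auto simp: af_D_eq_sgn[OF assms] norm_sgn)
qed

text \<open>In \<open>N' = h' \<xi>\<^sub>1 + h \<xi>\<^sub>1' + \<xi>\<^sub>3'\<close> the last two terms are \<open>h K\<^sub>1 \<xi>\<^sub>2\<close> and \<open>- K\<^sub>2 \<xi>\<^sub>2\<close>, which cancel
  since \<open>h K\<^sub>1 = K\<^sub>2\<close>.\<close>

lemma af_D_speed:
  assumes "s \<in> I"
  obtains D' where "(af_D I \<xi> has_vector_derivative D') (at s within I)"
    and "norm D' = \<bar>af_q I \<xi> s\<bar>"
proof -
  define h where "h = (\<lambda>t. K2 I \<xi> t / K1 I \<xi> t)"
  define N where "N = (\<lambda>t. h t *\<^sub>R \<xi> t + xi3 I \<xi> t)"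
  define h' where "h' = ddt I h s"
  define D' where "D' = (h' *\<^sub>R \<xi> s - (h' *\<^sub>R \<xi> s \<bullet> sgn (N s)) *\<^sub>R sgn (N s)) /\<^sub>R norm (N s)"
  note [simp] = frame_products[OF assms, unfolded norm_eq_1]
    unit_\<xi>[OF assms, unfolded norm_eq_1]
  have h: "(h has_vector_derivative h') (at s within I)"
    unfolding h'_def h_def
    using K1_differentiable K2_differentiable K1_pos assms
    by (intro ddt_works differentiable_divide) force+
  have "K1 I \<xi> s * h s = K2 I \<xi> s"
    using K1_pos[OF assms] by (simp add: h_def)
  then have "h s *\<^sub>R ddt I \<xi> s - K2 I \<xi> s *\<^sub>R xi2 I \<xi> s = 0"
    by (simp add: ddt_\<xi>[OF assms] mult.commute)
  moreover have "(N has_vector_derivative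
      (h s *\<^sub>R ddt I \<xi> s + h' *\<^sub>R \<xi> s) + (- K2 I \<xi> s) *\<^sub>R xi2 I \<xi> s) (at s within I)"
    unfolding N_def
    using h has_derivs_\<xi>(1)[OF assms] xi3_has_vector_derivative[OF assms]
    by (intro has_vector_derivative_add has_vector_derivative_scaleR)
       (auto simp: has_real_derivative_iff_has_vector_derivative)
  ultimately have N': "(N has_vector_derivative h' *\<^sub>R \<xi> s) (at s within I)"
    by (simp add: algebra_simps)
  have NN: "(norm (N s))\<^sup>2 = 1 + (h s)\<^sup>2"
    unfolding power2_norm_eq_inner by (simp add: N_def inner_add inner_commute power2_eq_square)
  moreover have "1 + (h s)\<^sup>2 > 0"
    by (simp add: add_pos_nonneg)
  ultimately have pos: "N s \<noteq> 0" "1 + (h s)\<^sup>2 > 0"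
    by auto
  have "(af_D I \<xi> has_vector_derivative D') (at s within I)"
    unfolding D'_def
    by (rule has_vector_derivative_transform[OF assms _ sgn_has_vector_derivative[OF N' pos(1)]])
       (simp add: af_D_eq_sgn N_def h_def)
  moreover have "norm D' = \<bar>af_q I \<xi> s\<bar>"
  proof -
    have "h' *\<^sub>R \<xi> s \<bullet> sgn (N s) = h' * h s / norm (N s)"
      by (simp add: sgn_div_norm N_def inner_add divide_inverse)
    then have "(norm D')\<^sup>2 = (h'\<^sup>2 - (h' * h s)\<^sup>2 / (1 + (h s)\<^sup>2)) / (1 + (h s)\<^sup>2)"
      unfolding D'_def norm_sgn_derivative_sq[OF pos(1)]
      by (simp add: power_divide NN unit_\<xi>[OF assms])
    also have "\<dots> = (h' / (1 + (h s)\<^sup>2))\<^sup>2"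
      using pos(2) by (simp add: divide_simps) (simp add: power2_eq_square algebra_simps)
    also have "h' / (1 + (h s)\<^sup>2) = af_q I \<xi> s"
    proof -
      have "(K1 I \<xi> s)\<^sup>2 / ((K1 I \<xi> s)\<^sup>2 + (K2 I \<xi> s)\<^sup>2) = 1 / (1 + (h s)\<^sup>2)"
        using K1_pos[OF assms] by (simp add: h_def power_divide divide_simps)
      then show ?thesis
        unfolding af_q_def h'_def h_def[symmetric] by simp
    qed
    finally have "(norm D')\<^sup>2 = \<bar>af_q I \<xi> s\<bar>\<^sup>2"
      by simp
    then show ?thesis
      by (rule power2_eq_imp_eq) simp_all
  qed
  ultimately show thesis by (rule that)
qed

end

theorem theorem7:
  fixes I :: "real set"
    and r \<xi> :: "real \<Rightarrow> real^3"
    and \<pi> :: "real \<Rightarrow> (real^3) set"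
    and s :: real
    and \<phi>\<^sub>1 \<phi>\<^sub>2 :: "real \<Rightarrow> real"
  assumes "myller_configuration I r \<xi> \<pi>"
    and "s \<in> I"
    and "oriented_angle I (xi2 I \<xi>) s \<phi>\<^sub>1" and "\<phi>\<^sub>1 differentiable (at s within I)"
    and "oriented_angle I (af_D I \<xi>) s \<phi>\<^sub>2" and "\<phi>\<^sub>2 differentiable (at s within I)"
  shows "af_p I \<xi> s = \<bar>ddt I \<phi>\<^sub>1 s\<bar>
       \<and> \<bar>af_q I \<xi> s\<bar> = \<bar>ddt I \<phi>\<^sub>2 s\<bar>
       \<and> (0 \<le> af_q I \<xi> s \<longrightarrow> af_q I \<xi> s = \<bar>ddt I \<phi>\<^sub>2 s\<bar>)"
proof -
  note M = assms(1) and s = \<open>s \<in> I\<close>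
  have "norm (ddt I (xi2 I \<xi>) s) = \<bar>ddt I \<phi>\<^sub>1 s\<bar>"
    using at_within_nontrivial[OF M s] s unit_xi2[OF M] ddt_xi2(1)[OF M s] assms(3) ddt_works[OF assms(4)]
    by (rule oriented_angle_speed)
  then have p: "af_p I \<xi> s = \<bar>ddt I \<phi>\<^sub>1 s\<bar>"
    by (simp add: norm_ddt_xi2[OF M s])
  obtain D' where D': "(af_D I \<xi> has_vector_derivative D') (at s within I)"
    and q: "norm D' = \<bar>af_q I \<xi> s\<bar>"
    using af_D_speed[OF M s] .
  have "norm D' = \<bar>ddt I \<phi>\<^sub>2 s\<bar>"
    using at_within_nontrivial[OF M s] s unit_af_D[OF M] D' assms(5) ddt_works[OF assms(6)]
    by (rule oriented_angle_speed)
  with p q show ?thesis by auto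
qed

end
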